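(* Let $X$ be a complete matching, let $k\neq\ell$ be firms, let $j\in X_k$, and let $X'$ be obtained from $X$ by moving the single worker $j$ from firm $k$ to firm $\ell$. Write $v_k=a_{kj}$, $v_\ell=a_{\ell j}$. Let $z^*$ be an optimal normalized wage vector for $X$, i.e. a minimizer over $z\ge 0$ of $\max_i R_i(X,z)$, and define $$\widehat\Phi_{j:k\to\ell}(z^* )=\max\left\{\max_{i\notin\{k,\ell\}}R_i(X,z^* ),\ \frac{D_k(X,z^* )-z_j^*}{B_k-v_k},\ \frac{D_\ell(X,z^* )+z_j^*}{B_\ell+v_\ell}\right\}.$$ Then $\Phi(X')\le\widehat\Phi_{j:k\to\ell}(z^* )$, and hence $$\alpha(X')\ge\frac{1}{\widehat\Phi_{j:k\to\ell}(z^* )}.$$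
   Context: Market: $F=\{1,\dots,m\}$ is the set of firms, $W$ the finite set of workers; firm $i$ values worker $h$ at $a_{ih}\ge 0$, additively: $V_i(T)=\sum_{h\in T}a_{ih}$. A complete matching $X=(X_1,\dots,X_m)$ is a partition of $W$ (parts may be empty), $X_i$ being the workers of firm $i$; $B_i=V_i(X_i)$ denotes the output of firm $i$ under $X$. For a matching $Y$ and $z=(z_h)_{h\in W}\ge 0$, with $[u]_+=\max\{u,0\}$, let $D_i(Y,z)=\sum_{h\in Y_i}z_h+\sum_{h\in W}[a_{ih}-z_h]_+$, and let $R_i(Y,z)=D_i(Y,z)/V_i(Y_i)$ if $V_i(Y_i)>0$, $R_i(Y,z)=+\infty$ if $V_i(Y_i)=0<D_i(Y,z)$, and $R_i(Y,z)=0$ if both vanish. Fractions with zero denominator are read by the same convention ($c/0=+\infty$ for $c>0$, $0/0=0$). $\Phi(Y)=\min_{z\ge 0}\max_{i\in F}R_i(Y,z)$. If $m=2$, the maximum over $i\notin\{k,\ell\}$ is omitted. Core: for a matching $Y$, profits $x_i\ge 0$ and wages $y_h\ge 0$ satisfy local financing if $x_i+\sum_{h\in Y_i}y_h=V_i(Y_i)$ for all $i$. The outcome $(Y,x,y)$ is in the $\alpha$-core if $\sum_{i\in I}x_i+\sum_{h\in T}y_h\ge\alpha\sum_{h\in T}\max_{i\in I}a_{ih}$ for all nonempty $I\subseteq F$ and all $T\subseteq W$. $\alpha(Y)$ is the largest $\alpha$ (supremum in $[0,+\infty]$) for which some nonnegative $x,y$ satisfying local financing make $(Y,x,y)$ an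 element of the $\alpha$-core. In the final inequality, $1/(+\infty)=0$ and $1/0=+\infty$. *)

theory Defs
  imports Complex_Main "HOL-Library.Extended_Real" "HOL-Library.Disjoint_Sets"
begin

text \<open>
  The firms are the numbers \<open>1, ..., m\<close>, the workers form a finite set \<open>W\<close>, and \<open>a i h\<close> is the
  value of worker \<open>h\<close> to firm \<open>i\<close>. Wage and profit vectors are functions of which only the
  values on \<open>W\<close> and on the set of firms matter.
\<close>

abbreviation firms :: "nat \<Rightarrow> nat set" where
  "firms m \<equiv> {1..m}"

definition complete_matching :: "nat \<Rightarrow> 'w set \<Rightarrow> (nat \<Rightarrow> 'w set) \<Rightarrow> bool" where
  "complete_matching m W X \<longleftrightarrow>
     disjoint_family_on X (firms m) \<and> (\<Union>i\<in>firms m. X i) = W"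

definition val :: "(nat \<Rightarrow> 'w \<Rightarrow> real) \<Rightarrow> nat \<Rightarrow> 'w set \<Rightarrow> real" where
  "val a i T = (\<Sum>h\<in>T. a i h)"

definition move :: "(nat \<Rightarrow> 'w set) \<Rightarrow> 'w \<Rightarrow> nat \<Rightarrow> nat \<Rightarrow> nat \<Rightarrow> 'w set" where
  "move X j k l = X(k := X k - {j}, l := insert j (X l))"

definition dual_cost ::
    "'w set \<Rightarrow> (nat \<Rightarrow> 'w \<Rightarrow> real) \<Rightarrow> (nat \<Rightarrow> 'w set) \<Rightarrow> ('w \<Rightarrow> real) \<Rightarrow> nat \<Rightarrow> real" where
  "dual_cost W a Y z i = (\<Sum>h\<in>Y i. z h) + (\<Sum>h\<in>W. max (a i h - z h) 0)"

definition ratio ::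
    "'w set \<Rightarrow> (nat \<Rightarrow> 'w \<Rightarrow> real) \<Rightarrow> (nat \<Rightarrow> 'w set) \<Rightarrow> ('w \<Rightarrow> real) \<Rightarrow> nat \<Rightarrow> ereal" where
  "ratio W a Y z i =
     (if val a i (Y i) > 0 then ereal (dual_cost W a Y z i / val a i (Y i))
      else if dual_cost W a Y z i > 0 then \<infinity> else 0)"

definition max_ratio ::
    "nat \<Rightarrow> 'w set \<Rightarrow> (nat \<Rightarrow> 'w \<Rightarrow> real) \<Rightarrow> (nat \<Rightarrow> 'w set) \<Rightarrow> ('w \<Rightarrow> real) \<Rightarrow> ereal" where
  "max_ratio m W a Y z = (MAX i\<in>firms m. ratio W a Y z i)"

definition nonneg_on :: "'b set \<Rightarrow> ('b \<Rightarrow> real) \<Rightarrow> bool" where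
  "nonneg_on S f \<longleftrightarrow> (\<forall>s\<in>S. 0 \<le> f s)"

definition optimal_wage ::
    "nat \<Rightarrow> 'w set \<Rightarrow> (nat \<Rightarrow> 'w \<Rightarrow> real) \<Rightarrow> (nat \<Rightarrow> 'w set) \<Rightarrow> ('w \<Rightarrow> real) \<Rightarrow> bool" where
  "optimal_wage m W a Y z \<longleftrightarrow> is_arg_min (max_ratio m W a Y) (nonneg_on W) z"

text \<open>
  For a complete matching \<open>Y\<close> the infimum below is a minimum: the sets
  \<open>{z. nonneg_on W z \<and> max_ratio m W a Y z \<le> r}\<close> with \<open>r\<close> real are, as sets of functions on the
  finite set \<open>W\<close>, closed, and they are bounded since
  \<open>z h \<le> dual_cost W a Y z i\<close> for the firm \<open>i\<close> employing \<open>h\<close>; if they are all empty, every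
  \<open>z\<close> attains the value \<open>\<infinity>\<close>.
\<close>

definition Phi :: "nat \<Rightarrow> 'w set \<Rightarrow> (nat \<Rightarrow> 'w \<Rightarrow> real) \<Rightarrow> (nat \<Rightarrow> 'w set) \<Rightarrow> ereal" where
  "Phi m W a Y = (INF z\<in>{z. nonneg_on W z}. max_ratio m W a Y z)"

text \<open>Division on \<^typ>\<open>ereal\<close> follows the convention for zero denominators used in \<open>ratio\<close>:\<close>

lemma ereal_divide_convention:
  "c > 0 \<Longrightarrow> ereal c / ereal 0 = \<infinity>"
  "ereal 0 / ereal 0 = 0"
  "d \<noteq> 0 \<Longrightarrow> ereal c / ereal d = ereal (c / d)"
  "1 / (\<infinity>::ereal) = 0"
  "1 / (0::ereal) = \<infinity>"
  by (simp_all add: divide_ereal_def flip: zero_ereal_def) (simp add: divide_inverse)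

definition Phi_hat ::
    "nat \<Rightarrow> 'w set \<Rightarrow> (nat \<Rightarrow> 'w \<Rightarrow> real) \<Rightarrow> (nat \<Rightarrow> 'w set) \<Rightarrow> 'w \<Rightarrow> nat \<Rightarrow> nat \<Rightarrow>
     ('w \<Rightarrow> real) \<Rightarrow> ereal" where
  "Phi_hat m W a X j k l z =
     Max ((\<lambda>i. ratio W a X z i) ` (firms m - {k, l}) \<union>
          {ereal (dual_cost W a X z k - z j) / ereal (val a k (X k) - a k j),
           ereal (dual_cost W a X z l + z j) / ereal (val a l (X l) + a l j)})"

definition local_financing ::
    "nat \<Rightarrow> (nat \<Rightarrow> 'w \<Rightarrow> real) \<Rightarrow> (nat \<Rightarrow> 'w set) \<Rightarrow> (nat \<Rightarrow> real) \<Rightarrow> ('w \<Rightarrow> real) \<Rightarrow> bool" where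
  "local_financing m a Y x y \<longleftrightarrow>
     (\<forall>i\<in>firms m. x i + (\<Sum>h\<in>Y i. y h) = val a i (Y i))"

definition alpha_core ::
    "nat \<Rightarrow> 'w set \<Rightarrow> (nat \<Rightarrow> 'w \<Rightarrow> real) \<Rightarrow> real \<Rightarrow> (nat \<Rightarrow> real) \<Rightarrow> ('w \<Rightarrow> real) \<Rightarrow> bool" where
  "alpha_core m W a \<alpha> x y \<longleftrightarrow>
     (\<forall>I T. I \<noteq> {} \<and> I \<subseteq> firms m \<and> T \<subseteq> W \<longrightarrow>
        (\<Sum>i\<in>I. x i) + (\<Sum>h\<in>T. y h) \<ge> \<alpha> * (\<Sum>h\<in>T. MAX i\<in>I. a i h))"

definition alpha :: "nat \<Rightarrow> 'w set \<Rightarrow> (nat \<Rightarrow> 'w \<Rightarrow> real) \<Rightarrow> (nat \<Rightarrow> 'w set) \<Rightarrow> ereal" where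
  "alpha m W a Y =
     Sup {ereal \<alpha> | \<alpha>. 0 \<le> \<alpha> \<and>
            (\<exists>x y. nonneg_on (firms m) x \<and> nonneg_on W y \<and> local_financing m a Y x y \<and>
                   alpha_core m W a \<alpha> x y)}"

end

theory Submission
  imports Defs
begin

text \<open>
  Keep the wage vector \<open>z\<close> after the move: it is feasible for the new matching, only the ratios
  of the two firms involved change, and the largest ratio is exactly the bound in the statement.
  For the core, if all ratios of a wage vector \<open>z\<close> are at most \<open>s > 0\<close>, then the wages \<open>z h / s\<close>
  leave firm \<open>i\<close> a profit of at least \<open>1 / s\<close> times its total positive part of \<open>a i h - z h\<close>,
  which is enough for the \<open>1 / s\<close>-core.
\<close>

lemma complete_matching_sub:
  "complete_matching m W Y \<Longrightarrow> i \<in> firms m \<Longrightarrow> Y i \<subseteq> W"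
  unfolding complete_matching_def by blast

lemma complete_matching_disjoint:
  "complete_matching m W Y \<Longrightarrow> i \<in> firms m \<Longrightarrow> i' \<in> firms m \<Longrightarrow> i \<noteq> i' \<Longrightarrow> Y i \<inter> Y i' = {}"
  unfolding complete_matching_def disjoint_family_on_def by blast

lemma complete_matching_move:
  assumes "complete_matching m W X" "k \<in> firms m" "l \<in> firms m" "k \<noteq> l" "j \<in> X k"
  shows "complete_matching m W (move X j k l)"
proof -
  have "disjoint_family_on (move X j k l) (firms m)"
    unfolding disjoint_family_on_def
  proof (intro ballI impI)
    fix i i' assume i: "i \<in> firms m" "i' \<in> firms m" "i \<noteq> i'"
    \<comment> \<open>As \<open>j\<close> lies in \<open>X k\<close>, disjointness keeps it out of
      every other part, so after the move only \<open>l\<close> holds it.\<close>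
    have "X i \<inter> X i' = {}" "i \<noteq> k \<Longrightarrow> j \<notin> X i" "i' \<noteq> k \<Longrightarrow> j \<notin> X i'"
      using i assms complete_matching_disjoint[OF assms(1)] by blast+
    then show "move X j k l i \<inter> move X j k l i' = {}"
      using i assms(4) unfolding move_def by (auto split: if_splits)
  qed
  moreover have "(\<Union>i\<in>firms m. move X j k l i) = (\<Union>i\<in>firms m. X i)"
  proof (intro equalityI subsetI)
    fix h assume "h \<in> (\<Union>i\<in>firms m. move X j k l i)"
    then show "h \<in> (\<Union>i\<in>firms m. X i)"
      using assms(2,5) unfolding move_def by (auto split: if_splits)
  next
    fix h assume "h \<in> (\<Union>i\<in>firms m. X i)"
    then obtain i where i: "i \<in> firms m" "h \<in> X i" by blast
    show "h \<in> (\<Union>i\<in>firms m. move X j k l i)"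
    proof (cases "h = j")
      case True
      then show ?thesis using assms(3) by (intro UN_I[of l]) (auto simp: move_def)
    next
      case False
      then show ?thesis using i by (intro UN_I[of i]) (auto simp: move_def)
    qed
  qed
  ultimately show ?thesis
    using assms(1) unfolding complete_matching_def by simp
qed

lemma val_matching_nonneg:
  assumes "\<And>i h. i \<in> firms m \<Longrightarrow> h \<in> W \<Longrightarrow> 0 \<le> a i h"
    and "complete_matching m W Y" and "i \<in> firms m"
  shows "0 \<le> val a i (Y i)"
  unfolding val_def
  using assms(1)[OF assms(3)] complete_matching_sub[OF assms(2,3)] by (intro sum_nonneg) blast

lemma dual_cost_nonneg:
  assumes "nonneg_on W z" "Y i \<subseteq> W"
  shows "0 \<le> dual_cost W a Y z i"
  unfolding dual_cost_def
  using assms by (intro add_nonneg_nonneg sum_nonneg) (auto simp: nonneg_on_def)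

text \<open>Bridge between the case distinction in \<open>ratio\<close> and the \<open>ereal\<close>
  quotients in \<open>Phi_hat\<close>. The signs matter: over output 0, a negative dual cost would
  give ratio 0 but quotient minus infinity.\<close>

lemma ratio_eq_divide:
  assumes "0 \<le> val a i (Y i)" "0 \<le> dual_cost W a Y z i"
  shows "ratio W a Y z i = ereal (dual_cost W a Y z i) / ereal (val a i (Y i))"
proof (cases "val a i (Y i) > 0")
  case True
  then show ?thesis by (simp add: ratio_def ereal_divide_convention)
next
  case False
  then have "val a i (Y i) = 0" using assms by simp
  then show ?thesis
    using assms(2) ereal_divide_convention(1)[of "dual_cost W a Y z i"] ereal_divide_convention(2)
    by (cases "dual_cost W a Y z i = 0") (auto simp: ratio_def)
qed

text \<open>A finite bound excludes the value infinity, so zero output forces a dual cost of at most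
  0 and the product form covers that case too.\<close>

lemma dual_cost_le_of_ratio_le:
  assumes "0 \<le> val a i (Y i)" "ratio W a Y z i \<le> ereal s"
  shows "dual_cost W a Y z i \<le> s * val a i (Y i)"
  using assms by (auto simp: ratio_def pos_divide_le_eq split: if_splits)

text \<open>The positive parts are summed over all of \<open>W\<close> whatever the matching, so
  with \<open>z\<close> fixed the move only shifts \<open>z j\<close> from the dual cost of
  \<open>k\<close> to that of \<open>l\<close>, and changes the two outputs by \<open>a k j\<close>
  and \<open>a l j\<close>.\<close>

lemma max_ratio_move:
  assumes fin: "finite W"
    and a: "\<And>i h. i \<in> firms m \<Longrightarrow> h \<in> W \<Longrightarrow> 0 \<le> a i h"
    and X: "complete_matching m W X"
    and kl: "k \<in> firms m" "l \<in> firms m" "k \<noteq> l"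
    and j: "j \<in> X k"
    and z: "nonneg_on W z"
  shows "max_ratio m W a (move X j k l) z = Phi_hat m W a X j k l z"
proof -
  let ?Y = "move X j k l"
  note Y = complete_matching_move[OF X kl j]
  have ratio_Y: "ratio W a ?Y z i = ereal (dual_cost W a ?Y z i) / ereal (val a i (?Y i))"
    if "i \<in> firms m" for i
    using val_matching_nonneg[OF a Y that] complete_matching_sub[OF Y that] z
    by (intro ratio_eq_divide dual_cost_nonneg)
  have fins: "finite (X k)" "finite (X l)"
    using complete_matching_sub[OF X] kl fin finite_subset by metis+
  \<comment> \<open>Inserting \<open>j\<close> therefore adds exactly one term to the sums over
    \<open>X l\<close>.\<close>
  have jl: "j \<notin> X l"
    using complete_matching_disjoint[OF X kl] j by blast
  have Yk: "?Y k = X k - {j}" and Yl: "?Y l = insert j (X l)"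
    using kl by (simp_all add: move_def)
  have "ratio W a ?Y z k
      = ereal (dual_cost W a X z k - z j) / ereal (val a k (X k) - a k j)"
    using ratio_Y[OF kl(1)] fins j
    by (simp add: dual_cost_def val_def Yk sum_diff1 algebra_simps)
  moreover have "ratio W a ?Y z l
      = ereal (dual_cost W a X z l + z j) / ereal (val a l (X l) + a l j)"
    using ratio_Y[OF kl(2)] fins jl
    by (simp add: dual_cost_def val_def Yl algebra_simps)
  moreover have "ratio W a ?Y z i = ratio W a X z i" if "i \<notin> {k, l}" for i
    using that by (simp add: ratio_def dual_cost_def move_def)
  then have "ratio W a ?Y z ` (firms m - {k, l}) = ratio W a X z ` (firms m - {k, l})"
    by (intro image_cong) auto
  moreover have "ratio W a ?Y z ` firms m
      = ratio W a ?Y z ` (firms m - {k, l}) \<union> {ratio W a ?Y z k, ratio W a ?Y z l}"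
    using kl by auto
  ultimately show ?thesis
    unfolding max_ratio_def Phi_hat_def by simp
qed

text \<open>Covers an infinite maximal ratio, whose reciprocal is 0. Zero wages, with each firm
  keeping its output, give a 0-core outcome.\<close>

lemma alpha_nonneg:
  assumes "\<And>i h. i \<in> firms m \<Longrightarrow> h \<in> W \<Longrightarrow> 0 \<le> a i h"
    and "complete_matching m W Y"
  shows "0 \<le> alpha m W a Y"
proof -
  let ?x = "\<lambda>i. val a i (Y i)" and ?y = "\<lambda>_. 0 :: real"
  have x: "nonneg_on (firms m) ?x"
    using val_matching_nonneg[OF assms] by (simp add: nonneg_on_def)
  then have "alpha_core m W a 0 ?x ?y"
    by (auto simp: alpha_core_def nonneg_on_def intro!: sum_nonneg)
  then have "ereal 0 \<le> alpha m W a Y"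
    unfolding alpha_def using x
    by (intro Sup_upper CollectI exI[of _ 0] exI[of _ ?x] exI[of _ ?y] conjI)
      (auto simp: nonneg_on_def local_financing_def)
  then show ?thesis by (simp add: zero_ereal_def)
qed

lemma alpha_core_scaled:
  assumes fin: "finite W" and z: "nonneg_on W z" and s: "0 < s"
    and x: "\<And>i. i \<in> firms m \<Longrightarrow> (\<Sum>h\<in>W. max (a i h - z h) 0) / s \<le> x i"
  shows "alpha_core m W a (1 / s) x (\<lambda>h. z h / s)"
  unfolding alpha_core_def
proof (intro allI impI, elim conjE)
  fix I T
  assume I: "I \<noteq> {}" "I \<subseteq> firms m" and T: "T \<subseteq> W"
  have finI: "finite I" using I finite_subset by auto
  let ?p = "\<lambda>i h. max (a i h - z h) 0"
  \<comment> \<open>A firm attaining the maximum values \<open>h\<close> at no more than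
    \<open>z h\<close> plus its own positive part; the other positive parts are nonnegative.\<close>
  have "(MAX i\<in>I. a i h) \<le> (\<Sum>i\<in>I. ?p i h) + z h" for h
  proof (rule Max.boundedI)
    fix v assume "v \<in> (\<lambda>i. a i h) ` I"
    then obtain i where i: "i \<in> I" "v = a i h" by blast
    have "?p i h \<le> (\<Sum>i\<in>I. ?p i h)"
      using i finI by (intro member_le_sum) auto
    then show "v \<le> (\<Sum>i\<in>I. ?p i h) + z h" using i by linarith
  qed (use I finI in auto)
  then have "(\<Sum>h\<in>T. MAX i\<in>I. a i h) \<le> (\<Sum>h\<in>T. \<Sum>i\<in>I. ?p i h) + (\<Sum>h\<in>T. z h)"
    by (simp add: sum_mono flip: sum.distrib)
  also have "(\<Sum>h\<in>T. \<Sum>i\<in>I. ?p i h) = (\<Sum>i\<in>I. \<Sum>h\<in>T. ?p i h)"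
    by (rule sum.swap)
  \<comment> \<open>Enlarging \<open>T\<close> to \<open>W\<close> yields a bound that the profits
    can meet for all coalitions at once.\<close>
  also have "\<dots> \<le> (\<Sum>i\<in>I. \<Sum>h\<in>W. ?p i h)"
    using fin T by (intro sum_mono sum_mono2) auto
  finally have "(\<Sum>h\<in>T. MAX i\<in>I. a i h) / s
      \<le> ((\<Sum>i\<in>I. \<Sum>h\<in>W. ?p i h) + (\<Sum>h\<in>T. z h)) / s"
    using s by (simp add: divide_right_mono)
  also have "\<dots> = (\<Sum>i\<in>I. (\<Sum>h\<in>W. ?p i h) / s) + (\<Sum>h\<in>T. z h / s)"
    by (simp add: add_divide_distrib sum_divide_distrib)
  also have "\<dots> \<le> (\<Sum>i\<in>I. x i) + (\<Sum>h\<in>T. z h / s)"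
    using x I(2) by (intro add_right_mono sum_mono) auto
  finally show "1 / s * (\<Sum>h\<in>T. MAX i\<in>I. a i h) \<le> sum x I + (\<Sum>h\<in>T. z h / s)"
    by simp
qed

lemma alpha_ge_inverse:
  assumes fin: "finite W" and z: "nonneg_on W z" and s: "0 < s"
    and D: "\<And>i. i \<in> firms m \<Longrightarrow> dual_cost W a Y z i \<le> s * val a i (Y i)"
  shows "ereal (1 / s) \<le> alpha m W a Y"
proof -
  let ?y = "\<lambda>h. z h / s"
  \<comment> \<open>Local financing leaves no other choice of profits once the wages are
    fixed.\<close>
  let ?x = "\<lambda>i. val a i (Y i) - (\<Sum>h\<in>Y i. ?y h)"
  \<comment> \<open>Dividing \<open>D\<close> by \<open>s\<close> bounds the output below by the
    wage bill plus the scaled positive parts; the wage bill cancels.\<close>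
  have x: "(\<Sum>h\<in>W. max (a i h - z h) 0) / s \<le> ?x i" if "i \<in> firms m" for i
    using D[OF that] s unfolding dual_cost_def
    by (simp add: field_simps flip: sum_divide_distrib)
  moreover have "nonneg_on (firms m) ?x"
    unfolding nonneg_on_def
  proof
    fix i assume "i \<in> firms m"
    have "0 \<le> (\<Sum>h\<in>W. max (a i h - z h) 0) / s"
      using s by (intro divide_nonneg_pos sum_nonneg) auto
    then show "0 \<le> ?x i" using x[OF \<open>i \<in> firms m\<close>] by linarith
  qed
  moreover have "nonneg_on W ?y"
    using z s by (simp add: nonneg_on_def)
  ultimately show ?thesis
    unfolding alpha_def using s alpha_core_scaled[OF fin z s x]
    by (intro Sup_upper CollectI exI[of _ "1 / s"] exI[of _ ?x] exI[of _ ?y] conjI)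
      (auto simp: local_financing_def)
qed

lemma alpha_ge_inverse_max_ratio:
  assumes fin: "finite W"
    and a: "\<And>i h. i \<in> firms m \<Longrightarrow> h \<in> W \<Longrightarrow> 0 \<le> a i h"
    and Y: "complete_matching m W Y"
    and z: "nonneg_on W z" and m: "firms m \<noteq> {}"
  shows "1 / max_ratio m W a Y z \<le> alpha m W a Y"
proof -
  let ?r = "max_ratio m W a Y z"
  have sub: "Y i \<subseteq> W" if "i \<in> firms m" for i
    using complete_matching_sub[OF Y that] .
  have v: "0 \<le> val a i (Y i)" if "i \<in> firms m" for i
    using val_matching_nonneg[OF a Y that] .
  have ratio_le: "ratio W a Y z i \<le> ?r" if "i \<in> firms m" for i
    unfolding max_ratio_def using that by (intro Max_ge) auto
  obtain i where i: "i \<in> firms m" using m by blast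
  \<comment> \<open>One nonnegative ratio suffices to leave only 0, a positive real or infinity for
    the maximum.\<close>
  have "0 \<le> ratio W a Y z i"
    using dual_cost_nonneg[of W z Y i a] z sub[OF i] by (auto simp: ratio_def)
  with ratio_le[OF i] have r0: "0 \<le> ?r" by (rule order_trans[rotated])
  have bound: "ereal (1 / s) \<le> alpha m W a Y" if "0 < s" "?r \<le> ereal s" for s
    using that v ratio_le
    by (intro alpha_ge_inverse[OF fin z] dual_cost_le_of_ratio_le) (auto intro: order_trans)
  show ?thesis
  proof (cases "?r = 0")
    case True
    \<comment> \<open>Every \<open>s > 0\<close> bounds the ratios, so \<open>alpha\<close> exceeds every \<open>1 / s\<close>.\<close>
    have "ereal B \<le> alpha m W a Y" for B
    proof -
      \<comment> \<open>Replacing \<open>B\<close> by \<open>max B 1\<close> makes its reciprocal an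
        admissible positive \<open>s\<close>.\<close>
      have "ereal (max B 1) \<le> alpha m W a Y"
        using bound[of "1 / max B 1"] True by (simp add: max_def)
      then show ?thesis by (rule order_trans[rotated]) simp
    qed
    then have "alpha m W a Y = \<infinity>" by (rule ereal_top)
    then show ?thesis by simp
  next
    case False
    show ?thesis
    proof (cases ?r)
      case (real r)
      then have "0 < r" using False r0 by (simp add: zero_ereal_def)
      then show ?thesis
        using bound[of r] real by (simp add: one_ereal_def)
    next
      case PInf
      then show ?thesis using alpha_nonneg[OF a Y] by simp
    next
      case MInf
      then show ?thesis using r0 by simp
    qed
  qed
qed

theorem corollary5:
  fixes m :: nat and W :: "'w set" and a :: "nat \<Rightarrow> 'w \<Rightarrow> real"
    and X :: "nat \<Rightarrow> 'w set" and k l :: nat and j :: 'w and z :: "'w \<Rightarrow> real"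
  assumes "finite W"
    and "\<And>i h. i \<in> firms m \<Longrightarrow> h \<in> W \<Longrightarrow> 0 \<le> a i h"
    and "complete_matching m W X"
    and "k \<in> firms m" and "l \<in> firms m" and "k \<noteq> l"
    and "j \<in> X k"
    and "optimal_wage m W a X z"
  shows "Phi m W a (move X j k l) \<le> Phi_hat m W a X j k l z
       \<and> alpha m W a (move X j k l) \<ge> 1 / Phi_hat m W a X j k l z"
proof -
  have z: "nonneg_on W z"
    using assms(8) by (simp add: optimal_wage_def is_arg_min_def)
  have eq: "max_ratio m W a (move X j k l) z = Phi_hat m W a X j k l z"
    using assms(1-7) z by (rule max_ratio_move)
  have "Phi m W a (move X j k l) \<le> max_ratio m W a (move X j k l) z"
    unfolding Phi_def using z by (intro INF_lower) simp
  \<comment> \<open>Firm \<open>k\<close> witnesses that the set of firms is nonempty.\<close>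
  moreover have "1 / max_ratio m W a (move X j k l) z \<le> alpha m W a (move X j k l)"
    using assms(4) by (intro alpha_ge_inverse_max_ratio[OF assms(1,2)
        complete_matching_move[OF assms(3-7)] z]) auto
  ultimately show ?thesis by (simp add: eq)
qed

end
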